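(* Let $0<\alpha<1$ and let $m$ be a positive integer with $m>\frac{2-\alpha}{1-\alpha}$. If all the entries $a_{ij}$ and $b_{ij}$ of the random matrix $M_n^{(\alpha)}=M_{n,\lceil\alpha n\rceil}$ are Haar-uniform on $\mathbb Z_p$, then $$\lim_{n\to\infty}\mathbb E\Big[\big|\mathrm{Hom}\big(\mathrm{Coker}(M_n^{(\alpha)}),(\mathbb Z/p\mathbb Z)^m\big)\big|\Big]=\infty.$$
   Context: Fix a prime $p$; $\mathbb Z_p$ is the ring of $p$-adic integers. For positive integers $n_1\ge n_2$, $M_{n_1,n_2}$ is the random $(n_1+n_2)\times(n_1+n_2)$ matrix over $\mathbb Z_p$ with block form $\begin{bmatrix}\mathrm{diag}(c_1,\dots,c_{n_1}) & A\\ B' & \mathrm{diag}(d_1,\dots,d_{n_2})\end{bmatrix}$, where $A$ is the $n_1\times n_2$ matrix with $(i,j)$ entry $a_{ij}$ and $B'$ is the $n_2\times n_1$ matrix with $(j,i)$ entry $b_{ij}$ ($1\le i\le n_1$, $1\le j\le n_2$). The $c_i,d_j$ are Haar-uniform on $\mathbb Z_p$, and all of the $a_{ij},b_{ij},c_i,d_j$ are mutually independent. $\mathrm{Coker}(M_{n_1,n_2})=\mathbb Z_p^{n_1+n_2}/\mathrm{im}(M_{n_1,n_2})$. *)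

theory Defs
  imports
    "HOL-Probability.Probability"
    "HOL-Algebra.Ring"
    "HOL-Algebra.Product_Groups"
    "HOL-Algebra.Elementary_Groups"
    "HOL-Computational_Algebra.Primes"
begin

text \<open>
  The ring of p-adic integers as the inverse limit of the rings of integers modulo powers of \<open>p\<close>:
  an element is a sequence whose \<open>k\<close>-th term is the canonical representative of a residue
  modulo \<open>p ^ k\<close>, consecutive terms being compatible.
\<close>

type_synonym padic = "nat \<Rightarrow> int"

definition padic_int :: "nat \<Rightarrow> padic ring" where
  "padic_int p =
    \<lparr>carrier = {x. \<forall>k. x k \<in> {0..<int p ^ k} \<and> x (Suc k) mod int p ^ k = x k},
     monoid.mult = (\<lambda>x y k. (x k * y k) mod int p ^ k),
     one = (\<lambda>k. 1 mod int p ^ k),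
     zero = (\<lambda>k. 0),
     add = (\<lambda>x y k. (x k + y k) mod int p ^ k)\<rparr>"

lemma padic_int_cring:
  assumes "p > 0"
  shows "cring (padic_int p)"
proof -
  have pos: "0 < int p ^ k" for k
    using assms by simp
  have red: "(a mod int p ^ Suc k) mod int p ^ k = a mod int p ^ k" for a k
    by (simp add: mod_mod_cancel)
  have car: "x \<in> carrier (padic_int p) \<longleftrightarrow>
      (\<forall>k. x k \<in> {0..<int p ^ k} \<and> x (Suc k) mod int p ^ k = x k)" for x
    by (simp add: padic_int_def)
  have closed: "(\<lambda>k. f k mod int p ^ k) \<in> carrier (padic_int p)"
    if "\<And>k. f (Suc k) mod int p ^ k = f k mod int p ^ k" for f
    using pos that by (simp add: car red del: power_Suc)
  have self: "x k mod int p ^ k = x k" if "x \<in> carrier (padic_int p)" for x k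
    using that by (simp add: car)
  have step: "x (Suc k) mod int p ^ k = x k" if "x \<in> carrier (padic_int p)" for x k
    using that by (simp add: car)
  have add_cl: "(\<lambda>k. (x k + y k) mod int p ^ k) \<in> carrier (padic_int p)"
    if "x \<in> carrier (padic_int p)" "y \<in> carrier (padic_int p)" for x y
    by (rule closed) (metis mod_add_eq step that)
  have mult_cl: "(\<lambda>k. (x k * y k) mod int p ^ k) \<in> carrier (padic_int p)"
    if "x \<in> carrier (padic_int p)" "y \<in> carrier (padic_int p)" for x y
    by (rule closed) (metis mod_mult_eq step that)
  have minus_cl: "(\<lambda>k. (- x k) mod int p ^ k) \<in> carrier (padic_int p)"
    if "x \<in> carrier (padic_int p)" for x
    by (rule closed) (metis mod_minus_eq step that)
  have one_cl: "(\<lambda>k. 1 mod int p ^ k) \<in> carrier (padic_int p)"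
    by (rule closed) simp
  have zero_cl: "(\<lambda>k. 0) \<in> carrier (padic_int p)"
    using pos by (simp add: car)
  show ?thesis
  proof (rule cringI)
    show "abelian_group (padic_int p)"
    proof (rule abelian_groupI, goal_cases)
      case (6 x)
      then show ?case
        by (intro bexI[OF _ minus_cl[OF 6]]) (simp add: padic_int_def mod_simps)
    qed (use add_cl zero_cl self in
         \<open>auto simp: padic_int_def fun_eq_iff mod_simps algebra_simps\<close>)
    show "Group.comm_monoid (padic_int p)"
      by (rule comm_monoidI)
         (use mult_cl one_cl self in
          \<open>auto simp: padic_int_def fun_eq_iff mod_simps algebra_simps\<close>)
  qed (simp add: padic_int_def fun_eq_iff mod_simps algebra_simps)
qed

text \<open>
  The inverse limit topology is the subspace topology inherited from the product topology on
  \<^typ>\<open>nat \<Rightarrow> int\<close> with \<^typ>\<open>int\<close> discrete, which is what \<^const>\<open>borel\<close> refers to here.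
\<close>

definition padic_borel :: "nat \<Rightarrow> padic measure" where
  "padic_borel p = restrict_space borel (carrier (padic_int p))"

definition haar_probability :: "nat \<Rightarrow> padic measure \<Rightarrow> bool" where
  "haar_probability p \<mu> \<longleftrightarrow>
     prob_space \<mu> \<and> sets \<mu> = sets (padic_borel p) \<and>
     (\<forall>x\<in>carrier (padic_int p). \<forall>A\<in>sets \<mu>.
        emeasure \<mu> ((\<lambda>y. x \<oplus>\<^bsub>padic_int p\<^esub> y) ` A) = emeasure \<mu> A)"

definition haar_uniform :: "nat \<Rightarrow> 'w measure \<Rightarrow> ('w \<Rightarrow> padic) \<Rightarrow> bool" where
  "haar_uniform p W X \<longleftrightarrow>
     X \<in> W \<rightarrow>\<^sub>M padic_borel p \<and> haar_probability p (distr W (padic_borel p) X)"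

text \<open>
  An \<open>N \<times> N\<close> matrix is a function of its row and column index, both ranging over \<open>{..<N}\<close>;
  values outside this range are irrelevant.
\<close>

definition free_module :: "('a, 'b) ring_scheme \<Rightarrow> nat \<Rightarrow> (nat \<Rightarrow> 'a) monoid" where
  "free_module R N = product_group {..<N} (\<lambda>_. add_monoid R)"

definition mat_vec ::
  "('a, 'b) ring_scheme \<Rightarrow> nat \<Rightarrow> (nat \<Rightarrow> nat \<Rightarrow> 'a) \<Rightarrow> (nat \<Rightarrow> 'a) \<Rightarrow> nat \<Rightarrow> 'a" where
  "mat_vec R N M v = (\<lambda>i\<in>{..<N}. \<Oplus>\<^bsub>R\<^esub>j\<in>{..<N}. M i j \<otimes>\<^bsub>R\<^esub> v j)"

definition coker ::
  "('a, 'b) ring_scheme \<Rightarrow> nat \<Rightarrow> (nat \<Rightarrow> nat \<Rightarrow> 'a) \<Rightarrow> (nat \<Rightarrow> 'a) set monoid" where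
  "coker R N M = free_module R N Mod (mat_vec R N M ` carrier (free_module R N))"

text \<open>
  Elements of \<^const>\<open>hom\<close> are unconstrained outside the carrier of the source, so each homomorphism
  is counted through its unique representative that is \<^const>\<open>undefined\<close> there.
\<close>

definition hom_count :: "('a, 'c) monoid_scheme \<Rightarrow> ('b, 'd) monoid_scheme \<Rightarrow> nat" where
  "hom_count G H = card (hom G H \<inter> extensional (carrier G))"

text \<open>
  The independent entries: \<open>EntA i j\<close> and \<open>EntB i j\<close> stand for \<open>a\<^sub>i\<^sub>j\<close> and \<open>b\<^sub>i\<^sub>j\<close>, \<open>EntC i\<close> and
  \<open>EntD j\<close> for \<open>c\<^sub>i\<close> and \<open>d\<^sub>j\<close>. Indices start at 0.
\<close>

datatype entry = EntA nat nat | EntB nat nat | EntC nat | EntD nat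

definition entries :: "nat \<Rightarrow> nat \<Rightarrow> entry set" where
  "entries n\<^sub>1 n\<^sub>2 =
     {EntA i j |i j. i < n\<^sub>1 \<and> j < n\<^sub>2} \<union> {EntB i j |i j. i < n\<^sub>1 \<and> j < n\<^sub>2} \<union>
     {EntC i |i. i < n\<^sub>1} \<union> {EntD j |j. j < n\<^sub>2}"

text \<open>Note that the entry of the lower left block in its row \<open>j\<close> and column \<open>i\<close> is \<open>b\<^sub>i\<^sub>j\<close>.\<close>

definition block_matrix :: "('a, 'b) ring_scheme \<Rightarrow> nat \<Rightarrow> (entry \<Rightarrow> 'a) \<Rightarrow> nat \<Rightarrow> nat \<Rightarrow> 'a" where
  "block_matrix R n\<^sub>1 x r s =
     (if r < n\<^sub>1 then
        (if s < n\<^sub>1 then (if r = s then x (EntC r) else \<zero>\<^bsub>R\<^esub>) else x (EntA r (s - n\<^sub>1)))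
      else
        (if s < n\<^sub>1 then x (EntB s (r - n\<^sub>1)) else (if r = s then x (EntD (r - n\<^sub>1)) else \<zero>\<^bsub>R\<^esub>)))"

text \<open>
  The distributions of the \<open>a\<^sub>i\<^sub>j\<close> and \<open>b\<^sub>i\<^sub>j\<close> are deliberately left arbitrary here.
\<close>

definition random_entries ::
  "nat \<Rightarrow> nat \<Rightarrow> nat \<Rightarrow> 'w measure \<Rightarrow> (entry \<Rightarrow> 'w \<Rightarrow> padic) \<Rightarrow> bool" where
  "random_entries p n\<^sub>1 n\<^sub>2 W X \<longleftrightarrow>
     prob_space W \<and>
     prob_space.indep_vars W (\<lambda>_. padic_borel p) X (entries n\<^sub>1 n\<^sub>2) \<and>
     (\<forall>i<n\<^sub>1. haar_uniform p W (X (EntC i))) \<and>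
     (\<forall>j<n\<^sub>2. haar_uniform p W (X (EntD j)))"

definition random_coker ::
  "nat \<Rightarrow> nat \<Rightarrow> nat \<Rightarrow> (entry \<Rightarrow> 'w \<Rightarrow> padic) \<Rightarrow> 'w \<Rightarrow> (nat \<Rightarrow> padic) set monoid" where
  "random_coker p n\<^sub>1 n\<^sub>2 X \<omega> =
     coker (padic_int p) (n\<^sub>1 + n\<^sub>2) (block_matrix (padic_int p) n\<^sub>1 (\<lambda>e. X e \<omega>))"

end

theory Submission
  imports Defs
begin

text \<open>
  A homomorphism from the cokernel of an \<open>N \<times> N\<close> matrix \<open>M\<close> over the p-adic integers to
  \<open>(\<int>/p)\<^sup>m\<close> is a homomorphism on the free module that kills the image of \<open>M\<close>
  (\<open>hom_count_coker\<close>). As the target has exponent \<open>p\<close>, such a homomorphism is an \<open>m \<times> N\<close>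
  matrix \<open>F\<close> over \<open>\<int>/p\<close>, and it kills the image exactly when \<open>F M = 0\<close> modulo \<open>p\<close>.

  Write \<open>N = n + k\<close> with \<open>k = \<lceil>\<alpha> n\<rceil>\<close>. Suppose that all of \<open>c\<^sub>1, \<dots>, c\<^sub>n\<close> are divisible
  by \<open>p\<close>; being independent and Haar-uniform, they are so with probability \<open>p\<^bsup>-n\<^esup>\<close>
  (\<open>prob_diagonal_divisible\<close>). The upper left \<open>n \<times> n\<close> block of \<open>M\<close> then vanishes modulo \<open>p\<close>.
  For an \<open>F\<close> supported on its first \<open>n\<close> columns the equation \<open>F M = 0\<close> therefore only says something
  about the last \<open>k\<close> columns of \<open>M\<close>: these are \<open>m k\<close> linear equations for the \<open>m n\<close> entries of \<open>F\<close>,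
  with at least \<open>p\<^bsup>m n - m k\<^esup>\<close> solutions (\<open>hom_count_coker_zero_block\<close>).

  This rare event alone makes the expectation at least \<open>p\<^bsup>m n - m k - n\<^esup>\<close>
  (\<open>expectation_hom_number_ge\<close>). Since \<open>k \<le> \<alpha> n + 1\<close>, the exponent is at least
  \<open>(m (1 - \<alpha>) - 1) n - m\<close>, and \<open>m (1 - \<alpha>) > 2 - \<alpha> > 1\<close>.

  For the expectation to be meaningful, the number of homomorphisms has to be a bounded measurable
  function. It is, because it depends on the entries only through their residues modulo \<open>p\<close>
  (\<open>hom_count_coker_cong_mod_p\<close>) and is at most the number of all homomorphisms from the free module,
  which is finite (\<open>finite_hom_free_module_padic\<close>).
\<close>

section \<open>Arithmetic of p-adic integers by levels\<close>

lemma padic_carrier_iff: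
  "x \<in> carrier (padic_int p) \<longleftrightarrow>
    (\<forall>k. x k \<in> {0..<int p ^ k} \<and> x (Suc k) mod int p ^ k = x k)"
  by (simp add: padic_int_def)

lemma padic_add: "x \<oplus>\<^bsub>padic_int p\<^esub> y = (\<lambda>k. (x k + y k) mod int p ^ k)"
  by (simp add: padic_int_def)

lemma padic_mult: "x \<otimes>\<^bsub>padic_int p\<^esub> y = (\<lambda>k. (x k * y k) mod int p ^ k)"
  by (simp add: padic_int_def)

lemma padic_zero: "\<zero>\<^bsub>padic_int p\<^esub> = (\<lambda>k. 0)"
  by (simp add: padic_int_def)

lemma padic_level_range:
  "x \<in> carrier (padic_int p) \<Longrightarrow> 0 \<le> x k \<and> x k < int p ^ k"
  by (simp add: padic_carrier_iff)

lemma padic_level_mod: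
  assumes "x \<in> carrier (padic_int p)" and "i \<le> j"
  shows "x j mod int p ^ i = x i"
  using \<open>i \<le> j\<close>
proof (induction j rule: dec_induct)
  case base
  show ?case using padic_level_range[OF assms(1), of i] by simp
next
  case (step j)
  have "x (Suc j) mod int p ^ i = (x (Suc j) mod int p ^ j) mod int p ^ i"
    using step.hyps by (simp add: mod_mod_cancel le_imp_power_dvd)
  also have "\<dots> = x i" using assms(1) step.IH by (simp add: padic_carrier_iff)
  finally show ?case .
qed

lemma padic_finsum_level:
  assumes "p > 0" and "finite A" and "f \<in> A \<rightarrow> carrier (padic_int p)"
  shows "(\<Oplus>\<^bsub>padic_int p\<^esub>j\<in>A. f j) k = (\<Sum>j\<in>A. f j k) mod int p ^ k"
proof -
  interpret cring "padic_int p" by (rule padic_int_cring[OF assms(1)])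
  show ?thesis using assms(2,3)
    by (induction A rule: finite_induct) (auto simp: padic_zero padic_add mod_simps Pi_iff)
qed

definition padic_of_int :: "nat \<Rightarrow> int \<Rightarrow> padic" where
  "padic_of_int p a = (\<lambda>k. a mod int p ^ k)"

lemma padic_of_int_carrier: "p > 0 \<Longrightarrow> padic_of_int p a \<in> carrier (padic_int p)"
  by (auto simp: padic_of_int_def padic_carrier_iff mod_mod_cancel)

text \<open>
  Dividing the representatives by \<open>p\<close> loses one digit, so the quotient at level \<open>k\<close> has to be read
  off from level \<open>k + 1\<close>.
\<close>

lemma padic_divide_by_p:
  assumes "p > 0" and x: "x \<in> carrier (padic_int p)" and "x 1 = 0"
  obtains y where "y \<in> carrier (padic_int p)"
    and "\<And>k. (int p * y k) mod int p ^ k = x k"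
proof
  define y where "y = (\<lambda>k. x (Suc k) div int p)"
  have dvd: "int p dvd x (Suc k)" for k
    using padic_level_mod[OF x, of 1 "Suc k"] \<open>x 1 = 0\<close> by (simp add: mod_eq_0_iff_dvd)
  have py: "int p * y k = x (Suc k)" for k
    using dvd by (simp add: y_def)
  show "y \<in> carrier (padic_int p)"
    unfolding padic_carrier_iff
  proof (intro allI conjI)
    fix k
    have "0 \<le> int p * y k" and "int p * y k < int p * int p ^ k"
      using padic_level_range[OF x, of "Suc k"] unfolding py by auto
    then show "y k \<in> {0..<int p ^ k}"
      using \<open>p > 0\<close> by (simp add: zero_le_mult_iff)
    have "int p * (y (Suc k) mod int p ^ k) = (int p * y (Suc k)) mod (int p * int p ^ k)"
      by (rule mult_mod_right)
    also have "\<dots> = x (Suc (Suc k)) mod int p ^ Suc k"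
      by (simp only: py power_Suc)
    also have "\<dots> = int p * y k"
      using padic_level_mod[OF x, of "Suc k" "Suc (Suc k)"] by (simp only: py)
    finally show "y (Suc k) mod int p ^ k = y k"
      using \<open>p > 0\<close> by simp
  qed
  show "(int p * y k) mod int p ^ k = x k" for k
    unfolding py using padic_level_mod[OF x, of k "Suc k"] by simp
qed

section \<open>Residues of a Haar-distributed p-adic integer\<close>

definition padic_residue_class :: "nat \<Rightarrow> int \<Rightarrow> padic set" where
  "padic_residue_class p a = {x \<in> carrier (padic_int p). x 1 = a}"

lemma measurable_padic_level:
  "(\<lambda>x. x k) \<in> padic_borel p \<rightarrow>\<^sub>M count_space UNIV"
proof -
  have "(\<lambda>x::padic. x k) -` {a} \<in> sets borel" for a
  proof (rule borel_open)
    have "continuous_on UNIV (\<lambda>x::padic. x k)" by (rule continuous_on_product_coordinates)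
    then show "open ((\<lambda>x::padic. x k) -` {a})" by (intro open_vimage discrete_topology_class.open_discrete)
  qed
  then have "(\<lambda>x::padic. x k) \<in> borel \<rightarrow>\<^sub>M count_space UNIV"
    by (simp add: measurable_count_space_eq2_countable)
  then show ?thesis
    unfolding padic_borel_def by (rule measurable_restrict_space1)
qed

lemma space_padic_borel: "space (padic_borel p) = carrier (padic_int p)"
  by (simp add: padic_borel_def space_restrict_space)

lemma padic_residue_class_sets: "padic_residue_class p a \<in> sets (padic_borel p)"
proof -
  have "(\<lambda>x. x 1) -` {a} \<inter> space (padic_borel p) \<in> sets (padic_borel p)"
    by (rule measurable_sets[OF measurable_padic_level]) simp
  then show ?thesis
    by (simp add: padic_residue_class_def space_padic_borel Int_def vimage_def conj_commute)
qed

text \<open>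
  This is what translation invariance will be applied to: it makes all residue classes
  modulo \<open>p\<close> equally likely.
\<close>

lemma padic_translate_residue_class:
  assumes "prime p" and "a \<in> {0..<int p}"
  shows "(\<lambda>y. padic_of_int p a \<oplus>\<^bsub>padic_int p\<^esub> y) ` padic_residue_class p 0 = padic_residue_class p a"
proof -
  have p: "p > 0" using assms(1) by (rule prime_gt_0_nat)
  interpret cring "padic_int p" by (rule padic_int_cring[OF p])
  let ?u = "padic_of_int p a"
  have u: "?u \<in> carrier (padic_int p)" by (rule padic_of_int_carrier[OF p])
  have u1: "?u 1 = a" using assms(2) by (simp add: padic_of_int_def)
  show ?thesis
  proof (intro equalityI subsetI)
    fix z assume "z \<in> (\<lambda>y. ?u \<oplus>\<^bsub>padic_int p\<^esub> y) ` padic_residue_class p 0"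
    then obtain y where y: "y \<in> carrier (padic_int p)" "y 1 = 0" "z = ?u \<oplus>\<^bsub>padic_int p\<^esub> y"
      by (auto simp: padic_residue_class_def)
    then show "z \<in> padic_residue_class p a"
      using u u1 assms(2) by (auto simp: padic_residue_class_def) (simp add: padic_add)
  next
    fix z assume z: "z \<in> padic_residue_class p a"
    define y where "y = z \<ominus>\<^bsub>padic_int p\<^esub> ?u"
    have zc: "z \<in> carrier (padic_int p)" and z1: "z 1 = a"
      using z by (auto simp: padic_residue_class_def)
    have yc: "y \<in> carrier (padic_int p)" using zc u by (simp add: y_def)
    have zy: "z = ?u \<oplus>\<^bsub>padic_int p\<^esub> y"
      using zc u by (simp add: y_def minus_eq a_lcomm r_neg)
    have "(a + y 1) mod int p = a"
      using arg_cong[OF zy, of "\<lambda>x. x 1"] z1 u1 by (simp add: padic_add)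
    then have "y 1 mod int p = 0"
      using assms(2) by (metis add_cancel_left_right add_diff_cancel_left' cancel_comm_monoid_add_class.diff_cancel mod_0 mod_diff_left_eq)
    then have "y 1 = 0" using padic_level_range[OF yc, of 1] by simp
    then show "z \<in> (\<lambda>y. ?u \<oplus>\<^bsub>padic_int p\<^esub> y) ` padic_residue_class p 0"
      using yc zy by (auto simp: padic_residue_class_def)
  qed
qed

lemma haar_uniform_residue_zero:
  assumes "prime p" and "prob_space W" and X: "haar_uniform p W X"
  shows "measure W (X -` padic_residue_class p 0 \<inter> space W) = 1 / real p"
proof -
  have p: "p > 0" using assms(1) by (rule prime_gt_0_nat)
  have Xm: "X \<in> W \<rightarrow>\<^sub>M padic_borel p" using X by (simp add: haar_uniform_def)
  define \<mu> where "\<mu> = distr W (padic_borel p) X"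
  interpret \<mu>: prob_space \<mu>
    using X by (simp add: haar_uniform_def haar_probability_def \<mu>_def)
  have sets: "padic_residue_class p a \<in> sets \<mu>" for a
    by (simp add: \<mu>_def padic_residue_class_sets)
  have eq: "measure \<mu> (padic_residue_class p a) = measure \<mu> (padic_residue_class p 0)"
    if "a \<in> {0..<int p}" for a
    using X sets[of 0] padic_of_int_carrier[OF p, of a]
      padic_translate_residue_class[OF assms(1) that]
    unfolding haar_uniform_def haar_probability_def \<mu>_def[symmetric] measure_def by metis
  have "space \<mu> = (\<Union>a\<in>{0..<int p}. padic_residue_class p a)"
    using padic_level_range[where k = 1]
    by (auto simp: \<mu>_def space_padic_borel padic_residue_class_def)
  moreover have "measure \<mu> (\<Union>a\<in>{0..<int p}. padic_residue_class p a)
      = (\<Sum>a\<in>{0..<int p}. measure \<mu> (padic_residue_class p a))"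
    using sets by (intro \<mu>.finite_measure_finite_Union)
      (auto simp: disjoint_family_on_def padic_residue_class_def)
  ultimately have "1 = real p * measure \<mu> (padic_residue_class p 0)"
    using \<mu>.prob_space sum.cong[OF refl eq, of "{0..<int p}" "\<lambda>a. a"] by simp
  then have "measure \<mu> (padic_residue_class p 0) = 1 / real p"
    using p by (simp add: field_simps)
  then show ?thesis
    by (simp add: \<mu>_def measure_distr[OF Xm] padic_residue_class_sets)
qed


section \<open>Homomorphisms out of a cokernel\<close>

text \<open>
  By Lagrange the index of the kernel is the order of the image. It serves below as a count of
  solutions of a linear system that avoids ranks.
\<close>

lemma (in group_hom) order_le_order_times_kernel:
  assumes "finite (carrier G)" and "finite (carrier H)"
  shows "order G \<le> order H * card (kernel G H h)"
proof -
  have "card (rcosets\<^bsub>G\<^esub> kernel G H h) \<le> order H"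
    unfolding order_def
  proof (rule card_inj_on_le)
    show "inj_on (\<lambda>X. the_elem (h ` X)) (rcosets\<^bsub>G\<^esub> kernel G H h)"
      using FactGroup_inj_on by (simp add: FactGroup_def)
    show "(\<lambda>X. the_elem (h ` X)) ` (rcosets\<^bsub>G\<^esub> kernel G H h) \<subseteq> carrier H"
      using FactGroup_the_elem_mem by (auto simp: FactGroup_def)
  qed (rule assms(2))
  then show ?thesis
    using G.lagrange[OF subgroup_kernel] by (metis mult_le_mono1)
qed

text \<open>
  The universal property of the quotient, in counting form. Composition with the projection is
  the bijection; it has to be cut down to the carrier to stay among extensional functions.
\<close>

lemma hom_count_FactGroup:
  assumes K: "K \<lhd> G" and H: "group H"
  shows "hom_count (G Mod K) H =
    card {f \<in> hom G H \<inter> extensional (carrier G). \<forall>x\<in>K. f x = \<one>\<^bsub>H\<^esub>}"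
proof -
  interpret K: normal K G by (rule K)
  interpret H: group H by (rule H)
  let ?C = "\<lambda>x. K #>\<^bsub>G\<^esub> x"
  let ?S = "{f \<in> hom G H \<inter> extensional (carrier G). \<forall>x\<in>K. f x = \<one>\<^bsub>H\<^esub>}"
  let ?T = "hom (G Mod K) H \<inter> extensional (carrier (G Mod K))"
  have carr: "carrier (G Mod K) = ?C ` carrier G"
    by (auto simp: FactGroup_def RCOSETS_def)
  have C_hom: "?C \<in> hom G (G Mod K)" by (rule K.r_coset_hom_Mod)
  have C_K: "?C x = \<one>\<^bsub>G Mod K\<^esub>" if "x \<in> K" for x
    using that K.coset_join2[OF _ K.is_subgroup] K.subset by (auto simp: FactGroup_def)
  have "bij_betw (\<lambda>g. \<lambda>x\<in>carrier G. g (?C x)) ?T ?S"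
    unfolding bij_betw_def
  proof (intro conjI equalityI subsetI)
    show "inj_on (\<lambda>g. \<lambda>x\<in>carrier G. g (?C x)) ?T"
    proof (rule inj_onI)
      fix g g'
      assume g: "g \<in> ?T" "g' \<in> ?T"
        and eq: "(\<lambda>x\<in>carrier G. g (?C x)) = (\<lambda>x\<in>carrier G. g' (?C x))"
      show "g = g'"
      proof (rule extensionalityI)
        fix y assume "y \<in> carrier (G Mod K)"
        then obtain x where "x \<in> carrier G" "y = ?C x" by (auto simp: carr)
        then show "g y = g' y" using fun_cong[OF eq, of x] by simp
      qed (use g in auto)
    qed
  next
    fix f assume "f \<in> (\<lambda>g. \<lambda>x\<in>carrier G. g (?C x)) ` ?T"
    then obtain g where g: "g \<in> hom (G Mod K) H" and f: "f = (\<lambda>x\<in>carrier G. g (?C x))" by auto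
    have "(\<lambda>x. g (?C x)) \<in> hom G H"
      using Group.hom_compose[OF C_hom g] by (simp add: comp_def)
    then have "f \<in> hom G H"
      unfolding f by (auto simp: hom_def)
    moreover have "f x = \<one>\<^bsub>H\<^esub>" if "x \<in> K" for x
      using that K.subset C_K[OF that] hom_one[OF g K.factorgroup_is_group H]
      by (auto simp: f)
    ultimately show "f \<in> ?S" by (auto simp: f)
  next
    fix f assume f: "f \<in> ?S"
    interpret f: group_hom G H f
      using f by unfold_locales auto
    obtain g where g: "g \<in> hom (G Mod K) H" "\<And>x. x \<in> carrier G \<Longrightarrow> g (?C x) = f x"
      using f.FactGroup_universal_kernel[OF K] f K.subset by (auto simp: kernel_def)
    interpret Q: group "G Mod K" by (rule K.factorgroup_is_group)
    let ?g = "restrict g (carrier (G Mod K))"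
    have "?g \<in> ?T" using Q.hom_restrict[OF g(1), of ?g] by simp
    moreover have "f = (\<lambda>x\<in>carrier G. ?g (?C x))"
      using f g(2) by (auto intro!: extensionalityI[of _ "carrier G"] simp: carr)
    ultimately show "f \<in> (\<lambda>g. \<lambda>x\<in>carrier G. g (?C x)) ` ?T" by blast
  qed
  then show ?thesis unfolding hom_count_def by (rule bij_betw_same_card)
qed

lemma carrier_free_module [simp]:
  "carrier (free_module R N) = ({..<N} \<rightarrow>\<^sub>E carrier R)"
  by (simp add: free_module_def)

lemma mult_free_module [simp]:
  "x \<otimes>\<^bsub>free_module R N\<^esub> y = (\<lambda>i\<in>{..<N}. x i \<oplus>\<^bsub>R\<^esub> y i)"
  by (simp add: free_module_def)

lemma one_free_module [simp]: "\<one>\<^bsub>free_module R N\<^esub> = (\<lambda>i\<in>{..<N}. \<zero>\<^bsub>R\<^esub>)"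
  by (simp add: free_module_def)

lemma comm_group_product_group:
  assumes "\<And>i. i \<in> I \<Longrightarrow> comm_group (G i)"
  shows "comm_group (product_group I G)"
proof (rule group.group_comm_groupI)
  show "group (product_group I G)"
    by (intro product_group comm_group.axioms(2) assms)
  show "x \<otimes>\<^bsub>product_group I G\<^esub> y = y \<otimes>\<^bsub>product_group I G\<^esub> x"
    if "x \<in> carrier (product_group I G)" "y \<in> carrier (product_group I G)" for x y
  proof -
    have "x i \<otimes>\<^bsub>G i\<^esub> y i = y i \<otimes>\<^bsub>G i\<^esub> x i" if "i \<in> I" for i
      using assms[OF that] \<open>x \<in> _\<close> \<open>y \<in> _\<close> that
      by (auto intro!: comm_monoid.m_comm comm_group.axioms(1))
    then show ?thesis by (auto intro: restrict_ext)
  qed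
qed

lemma comm_group_free_module:
  assumes "cring R"
  shows "comm_group (free_module R N)"
proof -
  interpret cring R by (rule assms)
  show ?thesis unfolding free_module_def
    using add.comm_group_axioms by (intro comm_group_product_group)
qed

lemma mat_vec_hom:
  assumes "cring R" and M: "\<And>i j. i < N \<Longrightarrow> j < N \<Longrightarrow> M i j \<in> carrier R"
  shows "mat_vec R N M \<in> hom (free_module R N) (free_module R N)"
proof -
  interpret cring R by (rule assms(1))
  show ?thesis
  proof (rule homI)
    fix x assume x: "x \<in> carrier (free_module R N)"
    have "(\<Oplus>\<^bsub>R\<^esub>j\<in>{..<N}. M i j \<otimes>\<^bsub>R\<^esub> x j) \<in> carrier R" if "i < N" for i
      using x M[OF that] by (intro finsum_closed Pi_I m_closed) (auto simp: PiE_mem)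
    then show "mat_vec R N M x \<in> carrier (free_module R N)"
      by (simp add: mat_vec_def)
  next
    fix x y assume x: "x \<in> carrier (free_module R N)" and y: "y \<in> carrier (free_module R N)"
    have "(\<Oplus>\<^bsub>R\<^esub>j\<in>{..<N}. M i j \<otimes>\<^bsub>R\<^esub> (\<lambda>j\<in>{..<N}. x j \<oplus>\<^bsub>R\<^esub> y j) j) =
        (\<Oplus>\<^bsub>R\<^esub>j\<in>{..<N}. M i j \<otimes>\<^bsub>R\<^esub> x j) \<oplus>\<^bsub>R\<^esub> (\<Oplus>\<^bsub>R\<^esub>j\<in>{..<N}. M i j \<otimes>\<^bsub>R\<^esub> y j)"
      if "i < N" for i
    proof -
      have "(\<Oplus>\<^bsub>R\<^esub>j\<in>{..<N}. M i j \<otimes>\<^bsub>R\<^esub> (\<lambda>j\<in>{..<N}. x j \<oplus>\<^bsub>R\<^esub> y j) j) =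
        (\<Oplus>\<^bsub>R\<^esub>j\<in>{..<N}. M i j \<otimes>\<^bsub>R\<^esub> x j \<oplus>\<^bsub>R\<^esub> M i j \<otimes>\<^bsub>R\<^esub> y j)"
      proof (rule finsum_cong')
        fix j assume "j \<in> {..<N}"
        then have "x j \<in> carrier R" "y j \<in> carrier R" "M i j \<in> carrier R"
          using x y M[OF that] by auto
        then show "M i j \<otimes>\<^bsub>R\<^esub> (\<lambda>j\<in>{..<N}. x j \<oplus>\<^bsub>R\<^esub> y j) j =
            M i j \<otimes>\<^bsub>R\<^esub> x j \<oplus>\<^bsub>R\<^esub> M i j \<otimes>\<^bsub>R\<^esub> y j"
          using \<open>j \<in> {..<N}\<close> by (simp add: r_distr)
      next
        show "(\<lambda>j. M i j \<otimes>\<^bsub>R\<^esub> x j \<oplus>\<^bsub>R\<^esub> M i j \<otimes>\<^bsub>R\<^esub> y j) \<in> {..<N} \<rightarrow> carrier R"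
          using x y M[OF that] by (intro Pi_I a_closed m_closed) auto
      qed simp
      also have "\<dots> = (\<Oplus>\<^bsub>R\<^esub>j\<in>{..<N}. M i j \<otimes>\<^bsub>R\<^esub> x j) \<oplus>\<^bsub>R\<^esub> (\<Oplus>\<^bsub>R\<^esub>j\<in>{..<N}. M i j \<otimes>\<^bsub>R\<^esub> y j)"
        using x y M[OF that] by (intro finsum_addf Pi_I m_closed) auto
      finally show ?thesis .
    qed
    then show "mat_vec R N M (x \<otimes>\<^bsub>free_module R N\<^esub> y) =
        mat_vec R N M x \<otimes>\<^bsub>free_module R N\<^esub> mat_vec R N M y"
      by (simp add: mat_vec_def cong: restrict_cong)
  qed
qed

lemma hom_count_coker:
  assumes R: "cring R" and M: "\<And>i j. i < N \<Longrightarrow> j < N \<Longrightarrow> M i j \<in> carrier R" and H: "group H"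
  shows "hom_count (coker R N M) H =
    card {f \<in> hom (free_module R N) H \<inter> extensional (carrier (free_module R N)).
      \<forall>v\<in>carrier (free_module R N). f (mat_vec R N M v) = \<one>\<^bsub>H\<^esub>}"
proof -
  interpret G: comm_group "free_module R N" by (rule comm_group_free_module[OF R])
  interpret T: group_hom "free_module R N" "free_module R N" "mat_vec R N M"
    using mat_vec_hom[OF R M] by unfold_locales auto
  have "mat_vec R N M ` carrier (free_module R N) \<lhd> free_module R N"
    using G.normal_iff_subgroup T.img_is_subgroup by blast
  then show ?thesis
    unfolding coker_def by (subst hom_count_FactGroup[OF _ H]) auto
qed

section \<open>Homomorphisms to a group of exponent p only see residues\<close>

lemma free_module_padic_nat_pow:
  assumes "p > 0" and z: "z \<in> carrier (free_module (padic_int p) N)" and "i < N"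
  shows "(z [^]\<^bsub>free_module (padic_int p) N\<^esub> (k::nat)) i = (\<lambda>l. (int k * z i l) mod int p ^ l)"
proof -
  interpret G: comm_group "free_module (padic_int p) N"
    by (rule comm_group_free_module[OF padic_int_cring[OF assms(1)]])
  show ?thesis
  proof (induction k)
    case 0
    show ?case unfolding G.nat_pow_0 one_free_module padic_zero using \<open>i < N\<close> by simp
  next
    case (Suc k)
    have "(z [^]\<^bsub>free_module (padic_int p) N\<^esub> Suc k) i =
        (\<lambda>l. ((int k * z i l) mod int p ^ l + z i l) mod int p ^ l)"
      using \<open>i < N\<close> Suc.IH by (simp add: padic_add)
    also have "\<dots> = (\<lambda>l. (int (Suc k) * z i l) mod int p ^ l)"
      by (intro ext) (simp only: mod_add_left_eq mod_add_right_eq of_nat_Suc distrib_right mult_1 add.commute)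
    finally show ?case .
  qed
qed

text \<open>
  Two vectors that agree modulo \<open>p\<close> differ by \<open>p z\<close> for a vector \<open>z\<close>, which is sent to the
  \<open>p\<close>-th power of the image of \<open>z\<close>.
\<close>

lemma hom_eq_if_congruent_mod_p:
  assumes "p > 0" and H: "group H" and exp: "\<And>h. h \<in> carrier H \<Longrightarrow> h [^]\<^bsub>H\<^esub> p = \<one>\<^bsub>H\<^esub>"
    and f: "f \<in> hom (free_module (padic_int p) N) H"
    and x: "x \<in> carrier (free_module (padic_int p) N)"
    and y: "y \<in> carrier (free_module (padic_int p) N)"
    and xy: "\<And>i. i < N \<Longrightarrow> x i 1 = y i 1"
  shows "f x = f y"
proof -
  interpret R: cring "padic_int p" by (rule padic_int_cring[OF assms(1)])
  interpret G: comm_group "free_module (padic_int p) N"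
    by (rule comm_group_free_module[OF R.is_cring])
  interpret f: group_hom "free_module (padic_int p) N" H f
    using f H G.group_axioms by (simp add: group_hom_def group_hom_axioms_def)
  have xc: "x i \<in> carrier (padic_int p)" and yc: "y i \<in> carrier (padic_int p)" if "i < N" for i
    using x y that by auto
  define d where "d = (\<lambda>i\<in>{..<N}. x i \<ominus>\<^bsub>padic_int p\<^esub> y i)"
  have d: "d \<in> carrier (free_module (padic_int p) N)"
    using xc yc by (auto simp: d_def)
  have dy: "d i \<oplus>\<^bsub>padic_int p\<^esub> y i = x i" if "i < N" for i
    using xc[OF that] yc[OF that] that
    by (simp add: d_def R.minus_eq R.a_assoc R.l_neg)
  have "\<exists>z. z \<in> carrier (padic_int p) \<and> (\<forall>k. (int p * z k) mod int p ^ k = d i k)" if "i < N" for i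
  proof -
    have dc: "d i \<in> carrier (padic_int p)" using d that by auto
    have "(d i 1 + y i 1) mod int p = y i 1"
      using fun_cong[OF dy[OF that], of 1] xy[OF that] by (simp add: padic_add)
    then have "(d i 1 + y i 1 - y i 1) mod int p = (y i 1 - y i 1) mod int p"
      by (metis mod_diff_left_eq)
    then have "d i 1 = 0" using padic_level_range[OF dc, of 1] by simp
    then show ?thesis using padic_divide_by_p[OF assms(1) dc] by metis
  qed
  then obtain z0 where z0: "\<And>i. i < N \<Longrightarrow> z0 i \<in> carrier (padic_int p)"
    "\<And>i k. i < N \<Longrightarrow> (int p * z0 i k) mod int p ^ k = d i k" by metis
  define z where "z = restrict z0 {..<N}"
  have z: "z \<in> carrier (free_module (padic_int p) N)" using z0 by (auto simp: z_def)
  have "z [^]\<^bsub>free_module (padic_int p) N\<^esub> p = d"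
  proof (rule extensionalityI)
    show "z [^]\<^bsub>free_module (padic_int p) N\<^esub> p \<in> extensional {..<N}"
      using G.nat_pow_closed[OF z, of p] by (auto simp: PiE_def)
    show "d \<in> extensional {..<N}" by (simp add: d_def)
    show "(z [^]\<^bsub>free_module (padic_int p) N\<^esub> p) i = d i" if "i \<in> {..<N}" for i
      using that z0 free_module_padic_nat_pow[OF assms(1) z, of i p] by (auto simp: z_def)
  qed
  then have "f d = \<one>\<^bsub>H\<^esub>"
    using exp[OF f.hom_closed[OF z]] f.hom_nat_pow[OF z, of p] by simp
  moreover have "d \<otimes>\<^bsub>free_module (padic_int p) N\<^esub> y = x"
  proof (rule extensionalityI)
    show "d \<otimes>\<^bsub>free_module (padic_int p) N\<^esub> y \<in> extensional {..<N}" by simp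
    show "x \<in> extensional {..<N}" using x by (simp add: PiE_def)
    show "(d \<otimes>\<^bsub>free_module (padic_int p) N\<^esub> y) i = x i" if "i \<in> {..<N}" for i
      using that dy by simp
  qed
  then have "f x = f d \<otimes>\<^bsub>H\<^esub> f y" using f.hom_mult[OF d y] by simp
  ultimately show ?thesis using f.hom_closed[OF y] by simp
qed

text \<open>
  A homomorphism is determined by its values on the finitely many vectors whose coordinates are
  the integers \<open>0, \<dots>, p - 1\<close>, because these represent all residues.
\<close>

lemma finite_hom_free_module_padic:
  assumes "p > 0" and H: "group H" and exp: "\<And>h. h \<in> carrier H \<Longrightarrow> h [^]\<^bsub>H\<^esub> p = \<one>\<^bsub>H\<^esub>"
    and fin: "finite (carrier H)"
  shows "finite (hom (free_module (padic_int p) N) H \<inter>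
    extensional (carrier (free_module (padic_int p) N)))"
proof -
  let ?G = "free_module (padic_int p) N"
  \<comment> \<open>The representative of the residue class of a vector with integer coordinates in \<open>0, \<dots>, p - 1\<close>.\<close>
  let ?r = "\<lambda>x. \<lambda>i\<in>{..<N}. padic_of_int p (x i 1)"
  define B where "B = ({..<N} \<rightarrow>\<^sub>E padic_of_int p ` {0..<int p})"
  have r: "?r x \<in> B" "?r x \<in> carrier ?G" "f x = f (?r x)"
    if x: "x \<in> carrier ?G" and f: "f \<in> hom ?G H" for x f
  proof -
    have range: "x i 1 \<in> {0..<int p}" if "i < N" for i
    proof -
      have "x i \<in> carrier (padic_int p)" using x that by auto
      from padic_level_range[OF this, of 1] show ?thesis by simp
    qed
    then show "?r x \<in> B"
      unfolding B_def restrict_PiE_iff by blast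
    show rc: "?r x \<in> carrier ?G" by (simp add: padic_of_int_carrier[OF assms(1)])
    show "f x = f (?r x)"
    proof (rule hom_eq_if_congruent_mod_p[OF assms(1) H exp f x rc])
      show "x i 1 = ?r x i 1" if "i < N" for i
        using range[OF that] that by (simp add: padic_of_int_def)
    qed
  qed
  have BG: "B \<subseteq> carrier ?G"
    unfolding B_def carrier_free_module
    by (intro PiE_mono) (use padic_of_int_carrier[OF assms(1)] in blast)
  show ?thesis
  proof (rule inj_on_finite)
    show "inj_on (\<lambda>f. restrict f B) (hom ?G H \<inter> extensional (carrier ?G))"
    proof (rule inj_onI)
      fix f g assume f: "f \<in> hom ?G H \<inter> extensional (carrier ?G)"
        and g: "g \<in> hom ?G H \<inter> extensional (carrier ?G)"
        and eq: "restrict f B = restrict g B"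
      show "f = g"
      proof (rule extensionalityI)
        fix x assume x: "x \<in> carrier ?G"
        show "f x = g x"
          using r[OF x, of f] r[OF x, of g] f g fun_cong[OF eq, of "?r x"] by simp
      qed (use f g in auto)
    qed
    show "(\<lambda>f. restrict f B) ` (hom ?G H \<inter> extensional (carrier ?G)) \<subseteq> (B \<rightarrow>\<^sub>E carrier H)"
    proof (rule image_subsetI)
      fix f assume "f \<in> hom ?G H \<inter> extensional (carrier ?G)"
      then have "f x \<in> carrier H" if "x \<in> B" for x
        using hom_in_carrier[of f ?G H x] BG that by blast
      then show "restrict f B \<in> (B \<rightarrow>\<^sub>E carrier H)" by simp
    qed
    show "finite (B \<rightarrow>\<^sub>E carrier H)"
      using fin by (auto simp: B_def intro!: finite_PiE)
  qed
qed

lemma mat_vec_padic_residue: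
  assumes "p > 0" and "\<And>i j. i < N \<Longrightarrow> j < N \<Longrightarrow> M i j \<in> carrier (padic_int p)"
    and v: "v \<in> carrier (free_module (padic_int p) N)" and "i < N"
  shows "mat_vec (padic_int p) N M v i 1 = (\<Sum>j<N. M i j 1 * v j 1) mod int p"
proof -
  interpret R: cring "padic_int p" by (rule padic_int_cring[OF assms(1)])
  have "(\<lambda>j. M i j \<otimes>\<^bsub>padic_int p\<^esub> v j) \<in> {..<N} \<rightarrow> carrier (padic_int p)"
    using assms by auto
  from padic_finsum_level[OF assms(1) _ this, of 1] show ?thesis
    using \<open>i < N\<close> by (simp add: mat_vec_def padic_mult mod_simps mod_sum_eq)
qed

lemma hom_count_coker_cong_mod_p:
  assumes "p > 0" and H: "group H" and exp: "\<And>h. h \<in> carrier H \<Longrightarrow> h [^]\<^bsub>H\<^esub> p = \<one>\<^bsub>H\<^esub>"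
    and M: "\<And>i j. i < N \<Longrightarrow> j < N \<Longrightarrow> M i j \<in> carrier (padic_int p)"
    and M': "\<And>i j. i < N \<Longrightarrow> j < N \<Longrightarrow> M' i j \<in> carrier (padic_int p)"
    and eq: "\<And>i j. i < N \<Longrightarrow> j < N \<Longrightarrow> M i j 1 = M' i j 1"
  shows "hom_count (coker (padic_int p) N M) H = hom_count (coker (padic_int p) N M') H"
proof -
  let ?G = "free_module (padic_int p) N"
  have R: "cring (padic_int p)" by (rule padic_int_cring[OF assms(1)])
  have "f (mat_vec (padic_int p) N M v) = f (mat_vec (padic_int p) N M' v)"
    if f: "f \<in> hom ?G H" and v: "v \<in> carrier ?G" for f v
  proof (rule hom_eq_if_congruent_mod_p[OF assms(1) H exp f])
    show "mat_vec (padic_int p) N M v \<in> carrier ?G" "mat_vec (padic_int p) N M' v \<in> carrier ?G"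
      using hom_in_carrier[OF mat_vec_hom[OF R M] v] hom_in_carrier[OF mat_vec_hom[OF R M'] v]
      by auto
    show "mat_vec (padic_int p) N M v i 1 = mat_vec (padic_int p) N M' v i 1" if "i < N" for i
      using mat_vec_padic_residue[OF assms(1) M v that]
        mat_vec_padic_residue[OF assms(1) M' v that] eq[OF that] by simp
  qed
  then have "{f \<in> hom ?G H \<inter> extensional (carrier ?G). \<forall>v\<in>carrier ?G. f (mat_vec (padic_int p) N M v) = \<one>\<^bsub>H\<^esub>} =
      {f \<in> hom ?G H \<inter> extensional (carrier ?G). \<forall>v\<in>carrier ?G. f (mat_vec (padic_int p) N M' v) = \<one>\<^bsub>H\<^esub>}"
    by (metis (no_types, lifting) IntD1)
  moreover have "hom_count (coker (padic_int p) N M) H =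
      card {f \<in> hom ?G H \<inter> extensional (carrier ?G). \<forall>v\<in>carrier ?G. f (mat_vec (padic_int p) N M v) = \<one>\<^bsub>H\<^esub>}"
    by (rule hom_count_coker[OF R _ H]) (rule M)
  moreover have "hom_count (coker (padic_int p) N M') H =
      card {f \<in> hom ?G H \<inter> extensional (carrier ?G). \<forall>v\<in>carrier ?G. f (mat_vec (padic_int p) N M' v) = \<one>\<^bsub>H\<^esub>}"
    by (rule hom_count_coker[OF R _ H]) (rule M')
  ultimately show ?thesis by simp
qed

section \<open>A lower bound from a block of zeros\<close>

abbreviation elementary_abelian :: "nat \<Rightarrow> nat \<Rightarrow> (nat \<Rightarrow> int) monoid" where
  "elementary_abelian p m \<equiv> product_group {..<m} (\<lambda>_. integer_mod_group p)"

lemma carrier_elementary_abelian: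
  "p > 0 \<Longrightarrow> carrier (elementary_abelian p m) = ({..<m} \<rightarrow>\<^sub>E {0..<int p})"
  by (simp add: carrier_integer_mod_group)

lemma finite_elementary_abelian: "p > 0 \<Longrightarrow> finite (carrier (elementary_abelian p m))"
  by (simp add: carrier_elementary_abelian finite_PiE del: carrier_product_group)

lemma order_elementary_abelian: "p > 0 \<Longrightarrow> order (elementary_abelian p m) = p ^ m"
  by (simp add: order_def carrier_elementary_abelian card_PiE del: carrier_product_group)

lemma elementary_abelian_exponent:
  assumes "p > 0" and h: "h \<in> carrier (elementary_abelian p m)"
  shows "h [^]\<^bsub>elementary_abelian p m\<^esub> p = \<one>\<^bsub>elementary_abelian p m\<^esub>"
proof -
  interpret E: group "elementary_abelian p m" by simp
  have "h [^]\<^bsub>elementary_abelian p m\<^esub> (k::nat) = (\<lambda>l\<in>{..<m}. (int k * h l) mod int p)" for k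
  proof (induction k)
    case 0
    then show ?case by simp
  next
    case (Suc k)
    have "(int k * h l mod int p + h l) mod int p = (int (Suc k) * h l) mod int p" for l
      by (simp only: mod_add_left_eq mod_add_right_eq of_nat_Suc distrib_right mult_1 add.commute)
    then show ?case using Suc.IH by (simp add: cong: restrict_cong)
  qed
  then show ?thesis by simp
qed

lemma sum_mult_mod:
  fixes q :: int
  shows "(\<Sum>i\<in>A. c i * (d i mod q)) mod q = (\<Sum>i\<in>A. c i * d i) mod q"
proof -
  have "(\<Sum>i\<in>A. c i * (d i mod q)) mod q = (\<Sum>i\<in>A. c i * (d i mod q) mod q) mod q"
    by (simp only: mod_sum_eq)
  also have "\<dots> = (\<Sum>i\<in>A. c i * d i) mod q"
    by (simp only: mod_mult_right_eq mod_sum_eq)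
  finally show ?thesis .
qed

lemma sum_mult_mod_add:
  fixes q :: int
  shows "(\<Sum>i\<in>A. c i * ((a i + b i) mod q)) mod q =
    ((\<Sum>i\<in>A. c i * a i) mod q + (\<Sum>i\<in>A. c i * b i) mod q) mod q"
  by (simp only: sum_mult_mod mod_add_eq distrib_left sum.distrib)

text \<open>
  The unknowns are \<open>n\<close> vectors in \<open>(\<int>/p)\<^sup>m\<close>, and each of the \<open>k\<close> equations asks one linear combination
  of them to vanish. The solutions form the kernel of a homomorphism
  \<open>((\<int>/p)\<^sup>m)\<^sup>n \<rightarrow> ((\<int>/p)\<^sup>m)\<^sup>k\<close>.
\<close>

lemma card_linear_system_mod_p_ge:
  fixes a :: "nat \<Rightarrow> nat \<Rightarrow> int"
  assumes "p > 0"
  shows "(p ^ m) ^ n \<le> (p ^ m) ^ k *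
    card {t \<in> {..<n} \<rightarrow>\<^sub>E carrier (elementary_abelian p m).
      \<forall>j<k. \<forall>l<m. int p dvd (\<Sum>i<n. a i j * t i l)}"
proof -
  let ?H = "elementary_abelian p m"
  let ?D = "product_group {..<n} (\<lambda>_. ?H)"
  let ?R = "product_group {..<k} (\<lambda>_. ?H)"
  let ?F = "\<lambda>t. \<lambda>j\<in>{..<k}. \<lambda>l\<in>{..<m}. (\<Sum>i<n. a i j * t i l) mod int p"
  have "?F \<in> hom ?D ?R"
  proof (rule homI)
    show "?F t \<in> carrier ?R" for t
      using assms by (simp add: carrier_integer_mod_group)
    show "?F (t \<otimes>\<^bsub>?D\<^esub> t') = ?F t \<otimes>\<^bsub>?R\<^esub> ?F t'" for t t'
      using sum_mult_mod_add[of "\<lambda>i. a i _" "\<lambda>i. t i _" "\<lambda>i. t' i _" "int p" "{..<n}"]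
      by (simp cong: restrict_cong)
  qed
  then interpret F: group_hom ?D ?R ?F
    by (simp add: group_hom_def group_hom_axioms_def)
  have "order ?D \<le> order ?R * card (kernel ?D ?R ?F)"
    using finite_elementary_abelian[OF assms, of m]
    by (intro F.order_le_order_times_kernel) (simp_all only: carrier_product_group[of "{..<n}"]
      carrier_product_group[of "{..<k}"] finite_PiE finite_lessThan)
  moreover have "order ?D = (p ^ m) ^ n" "order ?R = (p ^ m) ^ k"
    using order_elementary_abelian[OF assms, of m] by (simp_all add: order_def card_PiE)
  moreover have "kernel ?D ?R ?F = {t \<in> {..<n} \<rightarrow>\<^sub>E carrier ?H.
      \<forall>j<k. \<forall>l<m. int p dvd (\<Sum>i<n. a i j * t i l)}"
    by (auto simp: kernel_def fun_eq_iff restrict_def dvd_eq_mod_eq_0)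
  ultimately show ?thesis by simp
qed

text \<open>
  A solution \<open>t\<close> of the linear system given by the last \<open>k\<close> columns of the matrix yields the
  homomorphism \<open>x \<mapsto> x\<^sub>1 t\<^sub>1 + \<dots> + x\<^sub>n t\<^sub>n\<close>. It kills the last \<open>k\<close> columns by the choice of \<open>t\<close> and
  the first \<open>n\<close> because of the block of zeros; its values on the unit vectors recover \<open>t\<close>.
\<close>

lemma hom_count_coker_zero_block:
  assumes "prime p"
    and M: "\<And>i j. i < n + k \<Longrightarrow> j < n + k \<Longrightarrow> M i j \<in> carrier (padic_int p)"
    and zero: "\<And>i j. i < n \<Longrightarrow> j < n \<Longrightarrow> M i j 1 = 0"
  shows "(p ^ m) ^ n \<le>
    (p ^ m) ^ k * hom_count (coker (padic_int p) (n + k) M) (elementary_abelian p m)"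
proof -
  have p: "p > 0" and p1: "1 < int p" using prime_gt_1_nat[OF assms(1)] by auto
  let ?Z = "padic_int p" let ?G = "free_module ?Z (n + k)" let ?H = "elementary_abelian p m"
  let ?T = "{t \<in> {..<n} \<rightarrow>\<^sub>E carrier ?H.
      \<forall>j<k. \<forall>l<m. int p dvd (\<Sum>i<n. M i (n + j) 1 * t i l)}"
  let ?S = "{f \<in> hom ?G ?H \<inter> extensional (carrier ?G).
      \<forall>v\<in>carrier ?G. f (mat_vec ?Z (n + k) M v) = \<one>\<^bsub>?H\<^esub>}"
  define \<phi> where "\<phi> t = (\<lambda>x\<in>carrier ?G. \<lambda>l\<in>{..<m}. (\<Sum>i<n. x i 1 * t i l) mod int p)"
    for t :: "nat \<Rightarrow> nat \<Rightarrow> int"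
  have R: "cring ?Z" by (rule padic_int_cring[OF p])
  interpret G: comm_group ?G by (rule comm_group_free_module[OF R])
  have \<phi>_hom: "\<phi> t \<in> hom ?G ?H" for t
  proof (rule homI)
    show "\<phi> t x \<in> carrier ?H" if "x \<in> carrier ?G" for x
      using that p by (simp add: \<phi>_def carrier_integer_mod_group)
    show "\<phi> t (x \<otimes>\<^bsub>?G\<^esub> y) = \<phi> t x \<otimes>\<^bsub>?H\<^esub> \<phi> t y"
      if x: "x \<in> carrier ?G" and y: "y \<in> carrier ?G" for x y
    proof -
      have "(\<Sum>i<n. (x \<otimes>\<^bsub>?G\<^esub> y) i 1 * t i l) mod int p =
          ((\<Sum>i<n. x i 1 * t i l) mod int p + (\<Sum>i<n. y i 1 * t i l) mod int p) mod int p" for l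
        using sum_mult_mod_add[of "\<lambda>i. t i l" "\<lambda>i. x i 1" "\<lambda>i. y i 1" "int p" "{..<n}"]
        by (simp add: padic_add mult.commute)
      then show ?thesis
        using x y G.m_closed[OF x y]
        by (simp add: \<phi>_def del: mult_free_module carrier_free_module cong: restrict_cong)
    qed
  qed
  have \<phi>_kills: "\<phi> t (mat_vec ?Z (n + k) M v) = \<one>\<^bsub>?H\<^esub>"
    if t: "t \<in> ?T" and v: "v \<in> carrier ?G" for t v
  proof -
    have w: "mat_vec ?Z (n + k) M v \<in> carrier ?G"
      using v M by (intro hom_in_carrier[OF mat_vec_hom[OF R]])
    have col: "int p dvd (\<Sum>i<n. M i s 1 * t i l)" if "s < n + k" "l < m" for s l
    proof (cases "s < n")
      case True
      then show ?thesis using zero by simp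
    next
      case False
      then have s: "s - n < k" "n + (s - n) = s" using that by auto
      have "\<forall>j<k. \<forall>l<m. int p dvd (\<Sum>i<n. M i (n + j) 1 * t i l)" using t by blast
      then have "int p dvd (\<Sum>i<n. M i (n + (s - n)) 1 * t i l)" using s(1) that(2) by blast
      then show ?thesis unfolding s(2) .
    qed
    have "(\<Sum>i<n. mat_vec ?Z (n + k) M v i 1 * t i l) mod int p = 0" if l: "l < m" for l
    proof -
      have "(\<Sum>i<n. mat_vec ?Z (n + k) M v i 1 * t i l) =
          (\<Sum>i<n. t i l * ((\<Sum>s<n + k. M i s 1 * v s 1) mod int p))"
        using mat_vec_padic_residue[OF p _ v] M by (intro sum.cong refl) (simp add: mult.commute)
      then have "(\<Sum>i<n. mat_vec ?Z (n + k) M v i 1 * t i l) mod int p =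
          (\<Sum>i<n. t i l * (\<Sum>s<n + k. M i s 1 * v s 1)) mod int p"
        by (simp only: sum_mult_mod)
      also have "(\<Sum>i<n. t i l * (\<Sum>s<n + k. M i s 1 * v s 1)) =
          (\<Sum>s<n + k. (\<Sum>i<n. M i s 1 * t i l) * v s 1)"
        unfolding sum_distrib_left sum_distrib_right
        by (subst sum.swap) (simp add: ac_simps)
      also have "\<dots> mod int p = 0"
        by (rule dvd_imp_mod_0, rule dvd_sum, rule dvd_mult2) (use col[OF _ l] in simp)
      finally show ?thesis .
    qed
    then show ?thesis using w by (simp add: \<phi>_def cong: restrict_cong)
  qed
  have inj: "inj_on \<phi> ?T"
  proof (rule inj_onI)
    fix t t' assume t: "t \<in> ?T" and t': "t' \<in> ?T" and eq: "\<phi> t = \<phi> t'"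
    \<comment> \<open>A solution is read off from the values of its homomorphism on the unit vectors.\<close>
    have coord: "u i l = \<phi> u (\<lambda>j\<in>{..<n + k}. padic_of_int p (if j = i then 1 else 0)) l"
      if u: "u \<in> ?T" and i: "i < n" and l: "l < m" for u i l
    proof -
      have "u i \<in> carrier ?H" using u i by auto
      then have "u i \<in> {..<m} \<rightarrow>\<^sub>E {0..<int p}"
        unfolding carrier_elementary_abelian[OF p] .
      then have "u i l \<in> {0..<int p}" using l by (rule PiE_mem[OF _ lessThan_iff[THEN iffD2]])
      then have ul: "0 \<le> u i l" "u i l < int p" by simp_all
      have "(\<Sum>j<n. (if j = i then 1 else 0) * u j l) = (\<Sum>j<n. if j = i then u j l else 0)"
        by (rule sum.cong) simp_all
      also have "\<dots> = u i l"
        using i by simp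
      finally have "(\<Sum>j<n. (if j = i then 1 else 0) * u j l) = u i l" .
      moreover have "(\<Sum>j<n. (\<lambda>j\<in>{..<n + k}. padic_of_int p (if j = i then 1 else 0)) j 1 * u j l) =
          (\<Sum>j<n. (if j = i then 1 else 0) * u j l)"
        using p1 by (intro sum.cong) (auto simp: padic_of_int_def)
      ultimately show ?thesis
        using l ul padic_of_int_carrier[OF p] by (simp add: \<phi>_def)
    qed
    show "t = t'"
    proof (rule PiE_ext)
      show "t \<in> {..<n} \<rightarrow>\<^sub>E carrier ?H" "t' \<in> {..<n} \<rightarrow>\<^sub>E carrier ?H" using t t' by auto
      fix i assume "i \<in> {..<n}"
      then have i: "i < n" by simp
      show "t i = t' i"
      proof (rule PiE_ext)
        show "t i \<in> {..<m} \<rightarrow>\<^sub>E {0..<int p}" "t' i \<in> {..<m} \<rightarrow>\<^sub>E {0..<int p}"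
          using t t' i by (auto simp: carrier_elementary_abelian[OF p] simp del: carrier_product_group)
        show "t i l = t' i l" if "l \<in> {..<m}" for l
          using coord[OF t i, of l] coord[OF t' i, of l] that eq by simp
      qed
    qed
  qed
  have "\<phi> ` ?T \<subseteq> ?S"
    using \<phi>_hom \<phi>_kills by (auto simp del: carrier_free_module one_product_group) (simp add: \<phi>_def)
  moreover have "finite (hom ?G ?H \<inter> extensional (carrier ?G))"
    by (rule finite_hom_free_module_padic[OF p _ elementary_abelian_exponent[OF p]
        finite_elementary_abelian[OF p]]) simp_all
  then have "finite ?S" by (rule rev_finite_subset) blast
  ultimately have "card ?T \<le> card ?S"
    by (rule card_inj_on_le[OF inj])
  moreover have "hom_count (coker ?Z (n + k) M) ?H = card ?S"
    by (rule hom_count_coker[OF R]) (simp_all add: M)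
  ultimately have "card ?T \<le> hom_count (coker ?Z (n + k) M) ?H" by (rule ord_le_eq_trans[OF _ sym])
  then have "(p ^ m) ^ k * card ?T \<le> (p ^ m) ^ k * hom_count (coker ?Z (n + k) M) ?H"
    by (rule mult_le_mono2)
  with card_linear_system_mod_p_ge[OF p] show ?thesis by (rule order_trans)
qed

section \<open>The expected number of homomorphisms\<close>

lemma finite_entries: "finite (entries n k)"
proof -
  have "entries n k = (\<lambda>(i, j). EntA i j) ` ({..<n} \<times> {..<k}) \<union>
      (\<lambda>(i, j). EntB i j) ` ({..<n} \<times> {..<k}) \<union> EntC ` {..<n} \<union> EntD ` {..<k}"
    by (auto simp: entries_def)
  then show ?thesis by simp
qed

lemma block_matrix_carrier:
  assumes "cring R" and "\<And>e. e \<in> entries n k \<Longrightarrow> x e \<in> carrier R"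
    and "r < n + k" and "s < n + k"
  shows "block_matrix R n x r s \<in> carrier R"
proof -
  interpret cring R by (rule assms(1))
  show ?thesis using assms(2-) by (auto simp: block_matrix_def entries_def)
qed

lemma block_matrix_cong_level:
  assumes "\<And>e. e \<in> entries n k \<Longrightarrow> x e l = y e l" and "r < n + k" and "s < n + k"
  shows "block_matrix (padic_int p) n x r s l = block_matrix (padic_int p) n y r s l"
  using assms by (auto simp: block_matrix_def entries_def)

context
  fixes p n k m :: nat and W :: "'w measure" and X :: "entry \<Rightarrow> 'w \<Rightarrow> padic"
  assumes p: "prime p" and X: "random_entries p n k W X"
begin

abbreviation hom_number :: "'w \<Rightarrow> real" where
  "hom_number \<omega> \<equiv> real (hom_count (random_coker p n k X \<omega>)
    (product_group {..<m} (\<lambda>_. integer_mod_group p)))"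

lemma prob_space_W: "prob_space W"
  using X by (simp add: random_entries_def)

lemma entries_measurable: "e \<in> entries n k \<Longrightarrow> X e \<in> W \<rightarrow>\<^sub>M padic_borel p"
  using X by (simp add: random_entries_def prob_space.indep_vars_def2[OF prob_space_W])

lemma entries_carrier:
  "e \<in> entries n k \<Longrightarrow> \<omega> \<in> space W \<Longrightarrow> X e \<omega> \<in> carrier (padic_int p)"
  using measurable_space[OF entries_measurable] by (simp add: space_padic_borel)

text \<open>
  The number factors through the family of residues of the entries, which takes values in
  a countable discrete space.
\<close>

lemma hom_number_measurable: "hom_number \<in> borel_measurable W"
proof -
  have p0: "p > 0" using p by (rule prime_gt_0_nat)
  have R: "cring (padic_int p)" by (rule padic_int_cring[OF p0])
  \<comment> \<open>Replacing every entry by its residue turns the count into a function \<open>g\<close> of the residues.\<close>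
  define Y where "Y \<omega> = (\<lambda>e\<in>entries n k. X e \<omega> 1)" for \<omega>
  define g where "g y = real (hom_count (coker (padic_int p) (n + k)
      (block_matrix (padic_int p) n (\<lambda>e. padic_of_int p (y e)))) (elementary_abelian p m))" for y
  have "(\<lambda>\<omega>. X e \<omega> 1) \<in> W \<rightarrow>\<^sub>M count_space UNIV" if "e \<in> entries n k" for e
    by (rule measurable_compose[OF entries_measurable[OF that] measurable_padic_level])
  then have "Y \<in> W \<rightarrow>\<^sub>M PiM (entries n k) (\<lambda>_. count_space UNIV)"
    unfolding Y_def by (rule measurable_restrict)
  then have Y: "Y \<in> W \<rightarrow>\<^sub>M count_space (entries n k \<rightarrow>\<^sub>E UNIV)"
    by (subst (asm) count_space_PiM_finite[OF finite_entries]) simp_all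
  have gY: "(\<lambda>\<omega>. g (Y \<omega>)) \<in> borel_measurable W"
    by (rule measurable_compose[OF Y]) simp
  have "hom_number \<omega> = g (Y \<omega>)" if \<omega>: "\<omega> \<in> space W" for \<omega>
    unfolding g_def random_coker_def of_nat_eq_iff
  proof (rule hom_count_coker_cong_mod_p[OF p0 _ elementary_abelian_exponent[OF p0]])
    show "block_matrix (padic_int p) n (\<lambda>e. X e \<omega>) i j \<in> carrier (padic_int p)"
      if "i < n + k" "j < n + k" for i j
      using entries_carrier[OF _ \<omega>] that by (rule block_matrix_carrier[OF R])
    show "block_matrix (padic_int p) n (\<lambda>e. padic_of_int p (Y \<omega> e)) i j \<in> carrier (padic_int p)"
      if "i < n + k" "j < n + k" for i j
      using padic_of_int_carrier[OF p0] that by (rule block_matrix_carrier[OF R])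
    show "block_matrix (padic_int p) n (\<lambda>e. X e \<omega>) i j 1 =
        block_matrix (padic_int p) n (\<lambda>e. padic_of_int p (Y \<omega> e)) i j 1"
      if "i < n + k" "j < n + k" for i j
    proof (rule block_matrix_cong_level[OF _ that])
      fix e assume e: "e \<in> entries n k"
      show "X e \<omega> 1 = padic_of_int p (Y \<omega> e) 1"
        using padic_level_range[OF entries_carrier[OF e \<omega>], of 1] e
        by (simp add: Y_def padic_of_int_def)
    qed
  qed simp_all
  then have "hom_number \<in> borel_measurable W \<longleftrightarrow> (\<lambda>\<omega>. g (Y \<omega>)) \<in> borel_measurable W"
    by (rule measurable_cong)
  with gY show ?thesis by (rule iffD2[rotated])
qed

lemma hom_number_integrable: "integrable W hom_number"
proof -
  have p0: "p > 0" using p by (rule prime_gt_0_nat)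
  have R: "cring (padic_int p)" by (rule padic_int_cring[OF p0])
  let ?G = "free_module (padic_int p) (n + k)"
  define C where "C = card (hom ?G (elementary_abelian p m) \<inter> extensional (carrier ?G))"
  have fin: "finite (hom ?G (elementary_abelian p m) \<inter> extensional (carrier ?G))"
    using finite_hom_free_module_padic[OF p0 _ elementary_abelian_exponent[OF p0]
        finite_elementary_abelian[OF p0], of m "n + k"] by simp
  have "hom_number \<omega> \<le> real C" if \<omega>: "\<omega> \<in> space W" for \<omega>
  proof -
    have "hom_count (random_coker p n k X \<omega>) (elementary_abelian p m) =
      card {f \<in> hom ?G (elementary_abelian p m) \<inter> extensional (carrier ?G).
        \<forall>v\<in>carrier ?G. f (mat_vec (padic_int p) (n + k)
          (block_matrix (padic_int p) n (\<lambda>e. X e \<omega>)) v) = \<one>\<^bsub>elementary_abelian p m\<^esub>}"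
      unfolding random_coker_def
    proof (rule hom_count_coker[OF R])
      show "block_matrix (padic_int p) n (\<lambda>e. X e \<omega>) i j \<in> carrier (padic_int p)"
        if "i < n + k" "j < n + k" for i j
        using entries_carrier[OF _ \<omega>] that by (rule block_matrix_carrier[OF R])
    qed simp
    also have "\<dots> \<le> C" unfolding C_def by (intro card_mono fin) auto
    finally show ?thesis by simp
  qed
  then show ?thesis
    by (intro finite_measure.integrable_const_bound[where B = "real C"] hom_number_measurable)
      (auto intro!: prob_space.finite_measure prob_space_W)
qed

lemma prob_diagonal_divisible:
  "measure W {\<omega> \<in> space W. \<forall>i<n. X (EntC i) \<omega> 1 = 0} = (1 / real p) ^ n"
proof (cases "n = 0")
  case True
  then show ?thesis using prob_space.prob_space[OF prob_space_W] by simp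
next
  case False
  interpret prob_space W by (rule prob_space_W)
  let ?A = "padic_residue_class p 0"
  have C: "EntC ` {..<n} \<subseteq> entries n k" by (auto simp: entries_def)
  have "{\<omega> \<in> space W. \<forall>i<n. X (EntC i) \<omega> 1 = 0} = (\<Inter>e\<in>EntC ` {..<n}. X e -` ?A \<inter> space W)"
  proof (intro equalityI subsetI)
    fix \<omega> assume \<omega>: "\<omega> \<in> {\<omega> \<in> space W. \<forall>i<n. X (EntC i) \<omega> 1 = 0}"
    have "X (EntC i) \<omega> \<in> carrier (padic_int p)" if "i < n" for i
      using \<omega> that by (intro entries_carrier) (simp_all add: entries_def)
    then show "\<omega> \<in> (\<Inter>e\<in>EntC ` {..<n}. X e -` ?A \<inter> space W)"
      using \<omega> by (simp add: padic_residue_class_def)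
  next
    fix \<omega> assume "\<omega> \<in> (\<Inter>e\<in>EntC ` {..<n}. X e -` ?A \<inter> space W)"
    then have "\<forall>i<n. X (EntC i) \<omega> \<in> ?A \<and> \<omega> \<in> space W" by blast
    then show "\<omega> \<in> {\<omega> \<in> space W. \<forall>i<n. X (EntC i) \<omega> 1 = 0}"
      using False by (simp add: padic_residue_class_def)
  qed
  also have "prob \<dots> = (\<Prod>e\<in>EntC ` {..<n}. prob (X e -` ?A \<inter> space W))"
    using X False C
    by (intro indep_varsD[where I = "entries n k" and M' = "\<lambda>_. padic_borel p"])
      (auto simp: random_entries_def padic_residue_class_sets)
  also have "\<dots> = (\<Prod>i<n. prob (X (EntC i) -` ?A \<inter> space W))"
    by (subst prod.reindex) (auto simp: inj_on_def)
  also have "\<dots> = (1 / real p) ^ n"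
    using X haar_uniform_residue_zero[OF p prob_space_W] by (simp add: random_entries_def)
  finally show ?thesis .
qed

text \<open>
  Only the event that \<open>p\<close> divides the whole first diagonal block contributes to this bound.
\<close>

lemma expectation_hom_number_ge:
  "real ((p ^ m) ^ n) / real ((p ^ m) ^ k) * (1 / real p) ^ n \<le> prob_space.expectation W hom_number"
proof -
  have p0: "p > 0" using p by (rule prime_gt_0_nat)
  have R: "cring (padic_int p)" by (rule padic_int_cring[OF p0])
  interpret prob_space W by (rule prob_space_W)
  define c where "c = real ((p ^ m) ^ n) / real ((p ^ m) ^ k)"
  define A where "A = {\<omega> \<in> space W. \<forall>i<n. X (EntC i) \<omega> 1 = 0}"
  have "{\<omega> \<in> space W. X (EntC i) \<omega> 1 = 0} \<in> sets W" if "i < n" for i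
  proof -
    have "EntC i \<in> entries n k" using that by (simp add: entries_def)
    then have "(\<lambda>\<omega>. X (EntC i) \<omega> 1) \<in> W \<rightarrow>\<^sub>M count_space UNIV"
      by (rule measurable_compose[OF entries_measurable measurable_padic_level])
    then have "(\<lambda>\<omega>. X (EntC i) \<omega> 1) -` {0} \<inter> space W \<in> sets W"
      by (rule measurable_sets) simp
    then show ?thesis by (simp add: vimage_def Int_def conj_commute)
  qed
  then have "{\<omega> \<in> space W. \<forall>i\<in>{..<n}. X (EntC i) \<omega> 1 = 0} \<in> sets W"
    by (intro sets.sets_Collect_finite_All) auto
  then have A: "A \<in> sets W" unfolding A_def Ball_def lessThan_iff .
  have "c * indicator A \<omega> \<le> hom_number \<omega>" if \<omega>: "\<omega> \<in> space W" for \<omega>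
  proof (cases "\<omega> \<in> A")
    case True
    let ?M = "block_matrix (padic_int p) n (\<lambda>e. X e \<omega>)"
    have "(p ^ m) ^ n \<le> (p ^ m) ^ k * hom_count (coker (padic_int p) (n + k) ?M) (elementary_abelian p m)"
    proof (rule hom_count_coker_zero_block[OF p])
      show "?M i j \<in> carrier (padic_int p)" if "i < n + k" "j < n + k" for i j
        using entries_carrier[OF _ \<omega>] that by (rule block_matrix_carrier[OF R])
      show "?M i j 1 = 0" if "i < n" "j < n" for i j
        using that True by (simp add: block_matrix_def padic_zero A_def)
    qed
    then have "real ((p ^ m) ^ n) \<le> real ((p ^ m) ^ k) * hom_number \<omega>"
      unfolding random_coker_def of_nat_mult[symmetric] of_nat_le_iff .
    then show ?thesis
      using True p0 by (simp add: c_def divide_le_eq mult.commute)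
  qed simp
  then have "expectation (\<lambda>\<omega>. c * indicator A \<omega>) \<le> expectation hom_number"
    using A by (intro integral_mono hom_number_integrable) (auto simp: less_top[symmetric])
  moreover have "expectation (\<lambda>\<omega>. c * indicator A \<omega>) = c * prob A"
    using A by simp
  moreover have "prob A = (1 / real p) ^ n"
    unfolding A_def by (rule prob_diagonal_divisible)
  ultimately have "c * (1 / real p) ^ n \<le> expectation hom_number" by (simp only:)
  then show ?thesis unfolding c_def .
qed

end

theorem proposition7p1:
  fixes p m :: nat and \<alpha> :: real
    and n\<^sub>2 :: "nat \<Rightarrow> nat"
    and W :: "nat \<Rightarrow> 'w measure"
    and X :: "nat \<Rightarrow> entry \<Rightarrow> 'w \<Rightarrow> padic"
  assumes "prime p"
    and "0 < \<alpha>" and "\<alpha> < 1"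
    and "m > 0" and "real m > (2 - \<alpha>) / (1 - \<alpha>)"
    and n2: "\<And>n. n\<^sub>2 n = nat \<lceil>\<alpha> * real n\<rceil>"
    and "\<And>n. n \<ge> 1 \<Longrightarrow> random_entries p n (n\<^sub>2 n) (W n) (X n)"
    and "\<And>n i j. n \<ge> 1 \<Longrightarrow> i < n \<Longrightarrow> j < n\<^sub>2 n \<Longrightarrow> haar_uniform p (W n) (X n (EntA i j))"
    and "\<And>n i j. n \<ge> 1 \<Longrightarrow> i < n \<Longrightarrow> j < n\<^sub>2 n \<Longrightarrow> haar_uniform p (W n) (X n (EntB i j))"
  shows "filterlim
    (\<lambda>n. prob_space.expectation (W n) (\<lambda>\<omega>.
       real (hom_count (random_coker p n (n\<^sub>2 n) (X n) \<omega>)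
                       (product_group {..<m} (\<lambda>_. integer_mod_group p)))))
    at_top sequentially"
proof -
  define \<delta> where "\<delta> = real m * (1 - \<alpha>) - 1"
  have "2 - \<alpha> < real m * (1 - \<alpha>)"
    using assms(3,5) by (simp add: pos_divide_less_eq)
  then have \<delta>: "\<delta> > 0" using assms(3) by (simp add: \<delta>_def)
  have p: "1 < real p" using prime_gt_1_nat[OF assms(1)] by simp
  then have lnp: "0 < ln (real p)" by simp
  have lower: "ln (real p) * (- real m + \<delta> * real n) \<le>
      prob_space.expectation (W n) (\<lambda>\<omega>.
       real (hom_count (random_coker p n (n\<^sub>2 n) (X n) \<omega>)
                       (product_group {..<m} (\<lambda>_. integer_mod_group p))))"
    if n: "n \<ge> 1" for n
  proof -
    define e where "e = real m * real n - real m * real (n\<^sub>2 n) - real n"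
    \<comment> \<open>Rounding up costs at most \<open>m\<close> in the exponent.\<close>
    have "real (n\<^sub>2 n) \<le> \<alpha> * real n + 1"
      using assms(2) by (simp add: n2)
    then have "real m * real (n\<^sub>2 n) \<le> real m * (\<alpha> * real n + 1)"
      by (rule mult_left_mono) simp
    then have e: "- real m + \<delta> * real n \<le> e"
      by (simp add: e_def \<delta>_def algebra_simps)
    \<comment> \<open>The linear bound \<open>x \<le> exp x\<close> is enough for divergence.\<close>
    have "ln (real p) * (- real m + \<delta> * real n) \<le> ln (real p) * e"
      using e lnp by (intro mult_left_mono) auto
    also have "\<dots> \<le> exp (ln (real p) * e)"
      using exp_ge_add_one_self[of "ln (real p) * e"] by linarith
    also have "\<dots> = real p powr e"
      using p by (simp add: powr_def mult.commute)
    also have "\<dots> = real p ^ (m * n) / real p ^ (m * n\<^sub>2 n) / real p ^ n"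
      using p by (simp add: e_def powr_diff flip: powr_realpow)
    also have "\<dots> = real ((p ^ m) ^ n) / real ((p ^ m) ^ n\<^sub>2 n) * (1 / real p) ^ n"
      by (simp add: power_mult power_divide)
    also have "\<dots> \<le> prob_space.expectation (W n) (\<lambda>\<omega>.
       real (hom_count (random_coker p n (n\<^sub>2 n) (X n) \<omega>)
                       (product_group {..<m} (\<lambda>_. integer_mod_group p))))"
      by (rule expectation_hom_number_ge[OF assms(1) assms(7)[OF n]])
    finally show ?thesis .
  qed
  have "filterlim (\<lambda>n. \<delta> * real n) at_top sequentially"
    by (rule filterlim_tendsto_pos_mult_at_top[OF tendsto_const \<delta> filterlim_real_sequentially])
  then have "filterlim (\<lambda>n. - real m + \<delta> * real n) at_top sequentially"
    by (rule filterlim_tendsto_add_at_top[OF tendsto_const])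
  then have "filterlim (\<lambda>n. ln (real p) * (- real m + \<delta> * real n)) at_top sequentially"
    by (rule filterlim_tendsto_pos_mult_at_top[OF tendsto_const lnp])
  then show ?thesis
    by (rule filterlim_at_top_mono) (use lower in \<open>auto simp: eventually_at_top_linorder\<close>)
qed

end
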